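(* For any fixed decision rule $\tilde y_1(x)$, the inequality $$d_\ell^\top y\ge d_{l1}^\top\tilde y_1(x)+\min_{\pi\in\mathbb{R}^{m_\ell}}\Big\{\big(h_\ell-A_\ell x-B_{l1}\tilde y_1(x)\big)^\top\pi\ \Big|\ \pi\ge0,\ B_{l2}^\top\pi=d_{l2}\Big\}$$ is valid for $d_\ell^\top y\ge\phi(x)$, i.e. its right-hand side is at most $\phi(x)$ for all $x\in\{0,1\}^{n_x}$.
   Context: The lower-level variable is $y=(y_1,y_2)$ with $y_1\in Y_1\subseteq\{0,1\}^{n_{y_1}}$, $y_2\in Y_2\subseteq\mathbb{R}^{n_{y_2}}$, $d_\ell=(d_{l1},d_{l2})$, and for $x\in\{0,1\}^{n_x}$ $$\phi(x)=\max\{d_{l1}^\top y_1+d_{l2}^\top y_2 : y_1\in Y_1,\ y_2\in Y_2,\ B_{l1}y_1+B_{l2}y_2\le h_\ell-A_\ell x\},$$ with $m_\ell$ constraints and real data of compatible dimensions. Assumption: for every $x\in\{0,1\}^{n_x}$ this lower-level problem is feasible and bounded. A decision rule $\tilde y_1(x)$ is a binary-valued map $x\mapsto\tilde y_1(x)\in\{0,1\}^{n_{y_1}}$ on $\{0,1\}^{n_x}$, used to approximate the mapping from $x$ to an optimal lower-level $y_1$.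
   Formalization: False for arbitrary Y1, Y2 (e.g. Y2={0}, d_l2=B_l2=h=1, rest 0). Added: for y1 in Y1 and binary x, every y2 satisfying the linear constraints lies in Y2; and the rule's value lies in Y1 whenever some y2 satisfies the constraints with it. Max/min are read as extended-real sup/inf. *)

theory Defs
  imports "HOL-Analysis.Analysis"
begin

definition binary_vecs :: "(real ^ 'n) set" where
  "binary_vecs = {v. \<forall>i. v $ i = 0 \<or> v $ i = 1}"

text \<open>The order on \<open>real ^ 'm\<close> is the componentwise one.\<close>

definition lower_feasible ::
  "(real ^ 'ny1) set \<Rightarrow> (real ^ 'ny2) set \<Rightarrow> real ^ 'nx ^ 'm \<Rightarrow> real ^ 'ny1 ^ 'm \<Rightarrow> real ^ 'ny2 ^ 'm
    \<Rightarrow> real ^ 'm \<Rightarrow> real ^ 'nx \<Rightarrow> ((real ^ 'ny1) \<times> (real ^ 'ny2)) set" where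
  "lower_feasible Y1 Y2 A B1 B2 h x =
    {(y1, y2). y1 \<in> Y1 \<and> y2 \<in> Y2 \<and> B1 *v y1 + B2 *v y2 \<le> h - A *v x}"

definition lower_obj ::
  "real ^ 'ny1 \<Rightarrow> real ^ 'ny2 \<Rightarrow> (real ^ 'ny1) \<times> (real ^ 'ny2) \<Rightarrow> real" where
  "lower_obj d1 d2 y = d1 \<bullet> fst y + d2 \<bullet> snd y"

definition lower_feasible_bounded ::
  "(real ^ 'ny1) set \<Rightarrow> (real ^ 'ny2) set \<Rightarrow> real ^ 'nx ^ 'm \<Rightarrow> real ^ 'ny1 ^ 'm \<Rightarrow> real ^ 'ny2 ^ 'm
    \<Rightarrow> real ^ 'm \<Rightarrow> real ^ 'ny1 \<Rightarrow> real ^ 'ny2 \<Rightarrow> real ^ 'nx \<Rightarrow> bool" where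
  "lower_feasible_bounded Y1 Y2 A B1 B2 h d1 d2 x \<longleftrightarrow>
    lower_feasible Y1 Y2 A B1 B2 h x \<noteq> {} \<and>
    bdd_above (lower_obj d1 d2 ` lower_feasible Y1 Y2 A B1 B2 h x)"

text \<open>Optimal values are extended reals: an infeasible minimisation problem has value \<open>\<infinity>\<close>,
  one that is unbounded below has value \<open>-\<infinity>\<close>. The latter does occur for \<open>dual_value\<close>, namely
  when \<open>y1\<close> has no feasible completion \<open>y2\<close>.\<close>

definition phi ::
  "(real ^ 'ny1) set \<Rightarrow> (real ^ 'ny2) set \<Rightarrow> real ^ 'nx ^ 'm \<Rightarrow> real ^ 'ny1 ^ 'm \<Rightarrow> real ^ 'ny2 ^ 'm
    \<Rightarrow> real ^ 'm \<Rightarrow> real ^ 'ny1 \<Rightarrow> real ^ 'ny2 \<Rightarrow> real ^ 'nx \<Rightarrow> ereal" where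
  "phi Y1 Y2 A B1 B2 h d1 d2 x =
    (SUP y \<in> lower_feasible Y1 Y2 A B1 B2 h x. ereal (lower_obj d1 d2 y))"

text \<open>The LP dual of maximising \<open>d2 \<bullet> y2\<close> over all vectors \<open>y2\<close> (not just those in \<open>Y2\<close>) with
  \<open>B2 *v y2 \<le> h - A *v x - B1 *v y1\<close>.\<close>

definition dual_value ::
  "real ^ 'nx ^ 'm \<Rightarrow> real ^ 'ny1 ^ 'm \<Rightarrow> real ^ 'ny2 ^ 'm \<Rightarrow> real ^ 'm \<Rightarrow> real ^ 'ny2
    \<Rightarrow> real ^ 'nx \<Rightarrow> real ^ 'ny1 \<Rightarrow> ereal" where
  "dual_value A B1 B2 h d2 x y1 =
    (INF p \<in> {p. 0 \<le> p \<and> transpose B2 *v p = d2}. ereal ((h - A *v x - B1 *v y1) \<bullet> p))"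

end

(* LP duality by Farkas' lemma. Boundedness of the lower level at some feasible y1 makes the dual
   polyhedron {p. 0 \<le> p, B2^T p = d2}, which does not depend on y1, nonempty. Given this, the affine
   form of Farkas' lemma turns the bound "every feasible completion y2 of the rule satisfies
   d2 \<bullet> y2 \<le> phi - d1 \<bullet> yt" into a dual point of value at most phi - d1 \<bullet> yt. If the rule has no
   feasible completion this bound holds vacuously, so that case needs no separate treatment. *)

theory Submission imports Defs begin

text \<open>With finitely many generators, the orthant has only finitely generated linear images,
  and such cones are closed.\<close>

lemma nonneg_orthant_eq_convex_cone_hull:
  "{x::'a::euclidean_space. \<forall>i\<in>Basis. 0 \<le> x \<bullet> i} = convex_cone hull Basis"
proof
  show "convex_cone hull Basis \<subseteq> {x::'a. \<forall>i\<in>Basis. 0 \<le> x \<bullet> i}"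
    by (rule hull_minimal) (auto simp: inner_Basis convex_cone_iff inner_add_left)
next
  have sum_in: "(\<Sum>i\<in>T. (x \<bullet> i) *\<^sub>R i) \<in> convex_cone hull Basis"
    if "finite T" "T \<subseteq> Basis" "\<forall>i\<in>Basis. 0 \<le> x \<bullet> i" for T and x :: 'a
    using that
    by (induction T rule: finite_induct)
       (auto simp: convex_cone_hull_contains_0 hull_inc
             intro!: convex_cone_hull_add convex_cone_hull_mul)
  show "{x::'a. \<forall>i\<in>Basis. 0 \<le> x \<bullet> i} \<subseteq> convex_cone hull Basis"
    using sum_in[OF finite_Basis order_refl] by (auto simp: euclidean_representation)
qed

text \<open>The image of the orthant is the cone generated by the images of the basis vectors, hence
  closed and convex, so a hyperplane separates it strictly from \<open>d\<close>. Scaling within the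
  cone moves this hyperplane to the origin.\<close>

lemma farkas_linear_image:
  fixes f :: "'a::euclidean_space \<Rightarrow> 'b::euclidean_space"
  assumes lin: "linear f" and notin: "d \<notin> f ` {x. \<forall>i\<in>Basis. 0 \<le> x \<bullet> i}"
  obtains a where "a \<bullet> d < 0" "\<And>x. \<forall>i\<in>Basis. 0 \<le> x \<bullet> i \<Longrightarrow> 0 \<le> a \<bullet> f x"
proof -
  define K where "K = convex_cone hull (f ` Basis)"
  have K: "K = f ` {x. \<forall>i\<in>Basis. 0 \<le> x \<bullet> i}"
    unfolding K_def nonneg_orthant_eq_convex_cone_hull using lin by (rule convex_cone_hull_linear_image)
  have "closed K" "convex K"
    by (simp_all add: K_def closed_convex_cone_hull convex_convex_cone_hull)
  moreover have "d \<notin> K"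
    using notin K by simp
  ultimately obtain a b where ab: "a \<bullet> d < b" "\<forall>y\<in>K. b < a \<bullet> y"
    using separating_hyperplane_closed_point by blast
  \<comment> \<open>The cone contains 0, and \<open>a\<close> takes the value 0 there.\<close>
  have "b < 0"
    using ab(2) convex_cone_hull_contains_0[of "f ` Basis"] by (force simp: K_def)
  have "0 \<le> a \<bullet> y" if "y \<in> K" for y
  proof (rule ccontr)
    assume "\<not> 0 \<le> a \<bullet> y"
    then have neg: "a \<bullet> y < 0" by simp
    \<comment> \<open>A quotient of two negatives, this factor carries \<open>y\<close> onto the
      hyperplane at level \<open>b\<close>, which the cone does not meet.\<close>
    then have "(b / (a \<bullet> y)) *\<^sub>R y \<in> K"
      using \<open>b < 0\<close> that unfolding K_def by (intro convex_cone_hull_mul) (auto simp: divide_nonpos_neg)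
    then have "b < a \<bullet> ((b / (a \<bullet> y)) *\<^sub>R y)"
      using ab(2) by blast
    then show False
      using neg by simp
  qed
  then show thesis
    using that[of a] ab(1) \<open>b < 0\<close> K by auto
qed

lemma nonneg_vec_iff_Basis:
  fixes p :: "real ^ 'm"
  shows "(\<forall>i\<in>Basis. 0 \<le> p \<bullet> i) \<longleftrightarrow> 0 \<le> p"
  by (auto simp: less_eq_vec_def Basis_vec_def inner_axis)

lemma inner_transpose_mult:
  fixes B :: "real ^ 'n ^ 'm"
  shows "a \<bullet> (transpose B *v p) = (B *v a) \<bullet> p"
  by (metis dot_lmul_matrix inner_commute transpose_matrix_vector)

lemma nonneg_vec_if_inner_nonneg:
  fixes v :: "real ^ 'm"
  assumes "\<And>p. 0 \<le> p \<Longrightarrow> 0 \<le> v \<bullet> p"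
  shows "0 \<le> v"
  unfolding less_eq_vec_def
proof
  fix i
  have "0 \<le> v \<bullet> axis i 1"
    by (rule assms) (simp add: less_eq_vec_def axis_def)
  then show "(0 :: real ^ 'm) $ i \<le> v $ i"
    by (simp add: inner_axis)
qed

lemma inner_vec_nonneg:
  fixes v p :: "real ^ 'm"
  assumes "0 \<le> v" "0 \<le> p"
  shows "0 \<le> v \<bullet> p"
  using assms by (auto simp: inner_vec_def less_eq_vec_def intro!: sum_nonneg)

lemma farkas_transpose:
  fixes B :: "real ^ 'n ^ 'm"
  assumes "\<nexists>p. 0 \<le> p \<and> transpose B *v p = d"
  obtains a where "a \<bullet> d < 0" "0 \<le> B *v a"
proof -
  have "d \<notin> (\<lambda>p. transpose B *v p) ` {p. \<forall>i\<in>Basis. 0 \<le> p \<bullet> i}"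
    using assms by (auto simp: nonneg_vec_iff_Basis)
  then obtain a where a: "a \<bullet> d < 0" "\<And>p. \<forall>i\<in>Basis. 0 \<le> p \<bullet> i \<Longrightarrow> 0 \<le> a \<bullet> (transpose B *v p)"
    using farkas_linear_image[OF matrix_vector_mul_linear] by blast
  have "0 \<le> B *v a"
    by (rule nonneg_vec_if_inner_nonneg) (use a(2) in \<open>simp add: nonneg_vec_iff_Basis flip: inner_transpose_mult\<close>)
  with a(1) that show thesis by blast
qed

text \<open>A Farkas certificate \<open>a\<close> against dual feasibility is a primal ray: moving
  from \<open>y0\<close> along \<open>-a\<close> keeps the constraints and increases the objective
  without limit.\<close>

lemma dual_feasible_if_primal_bounded:
  fixes B :: "real ^ 'n ^ 'm"
  assumes feas: "B *v y0 \<le> c" and bound: "\<And>y. B *v y \<le> c \<Longrightarrow> d \<bullet> y \<le> M"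
  shows "\<exists>p. 0 \<le> p \<and> transpose B *v p = d"
proof (rule ccontr)
  assume "\<nexists>p. 0 \<le> p \<and> transpose B *v p = d"
  then obtain a where a: "a \<bullet> d < 0" "0 \<le> B *v a"
    using farkas_transpose by blast
  \<comment> \<open>The step length at which the objective is exactly \<open>M + 1\<close>.\<close>
  define t where "t = (d \<bullet> y0 - M - 1) / (a \<bullet> d)"
  have "d \<bullet> y0 \<le> M" using bound feas by blast
  then have "0 \<le> t" using a(1) by (simp add: t_def divide_nonpos_neg)
  have "B *v (y0 - t *\<^sub>R a) = B *v y0 - t *\<^sub>R (B *v a)"
    by (simp add: matrix_vector_mult_diff_distrib matrix_vector_mult_scaleR)
  also have "\<dots> \<le> c"
  proof -
    have "(B *v y0 - t *\<^sub>R (B *v a)) $ i \<le> c $ i" for i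
    proof -
      have "(B *v y0) $ i \<le> c $ i" "0 \<le> t * (B *v a) $ i"
        using feas a(2) \<open>0 \<le> t\<close> by (auto simp: less_eq_vec_def)
      then show ?thesis by simp
    qed
    then show ?thesis by (simp add: less_eq_vec_def)
  qed
  finally have "d \<bullet> (y0 - t *\<^sub>R a) \<le> M" by (rule bound)
  moreover have "d \<bullet> (y0 - t *\<^sub>R a) = M + 1"
    using a(1) by (simp add: t_def inner_diff_right inner_commute)
  ultimately show False by simp
qed

text \<open>The bound on \<open>c \<bullet> p\<close> is turned into an equation by a slack, so the
  conic Farkas lemma applies to the pair of \<open>p\<close> and slack. The point \<open>p0\<close>
  is what allows the primal polyhedron to be empty.\<close>

lemma affine_farkas:
  fixes B :: "real ^ 'n ^ 'm"
  assumes p0: "0 \<le> p0" "transpose B *v p0 = d"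
    and bound: "\<And>y. B *v y \<le> c \<Longrightarrow> d \<bullet> y \<le> z"
  shows "\<exists>p. 0 \<le> p \<and> transpose B *v p = d \<and> c \<bullet> p \<le> z"
proof (rule ccontr)
  assume no: "\<nexists>p. 0 \<le> p \<and> transpose B *v p = d \<and> c \<bullet> p \<le> z"
  \<comment> \<open>the second argument of \<open>f\<close> is the slack in \<open>c \<bullet> p \<le> z\<close>\<close>
  define f where "f = (\<lambda>q :: (real ^ 'm) \<times> real. (transpose B *v fst q, c \<bullet> fst q + snd q))"
  have nonneg: "(\<forall>i\<in>Basis. 0 \<le> q \<bullet> i) \<longleftrightarrow> 0 \<le> fst q \<and> 0 \<le> snd q" for q :: "(real ^ 'm) \<times> real"
    by (auto simp: Basis_prod_def inner_prod_def ball_Un nonneg_vec_iff_Basis)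
  have "linear f"
    by (rule linearI)
       (auto simp: f_def matrix_vector_right_distrib matrix_vector_mult_scaleR inner_add_right algebra_simps
             simp del: transpose_matrix_vector)
  moreover have "(d, z) \<notin> f ` {q. \<forall>i\<in>Basis. 0 \<le> q \<bullet> i}"
    using no by (force simp: f_def nonneg)
  ultimately obtain w where w: "w \<bullet> (d, z) < 0" "\<And>q. \<forall>i\<in>Basis. 0 \<le> q \<bullet> i \<Longrightarrow> 0 \<le> w \<bullet> f q"
    using farkas_linear_image by blast
  obtain a b where "w = (a, b)" by fastforce
  then have sep: "a \<bullet> d + b * z < 0"
    and pos: "0 \<le> p \<Longrightarrow> 0 \<le> s \<Longrightarrow> 0 \<le> (B *v a) \<bullet> p + b * (c \<bullet> p + s)" for p s
    using w(1) w(2)[of "(p, s)"] by (simp_all add: f_def nonneg inner_transpose_mult del: transpose_matrix_vector)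
  \<comment> \<open>Test the separator on a pure slack.\<close>
  have "0 \<le> b"
    using pos[of 0 1] by simp
  have Ba: "0 \<le> B *v a + b *\<^sub>R c"
    by (rule nonneg_vec_if_inner_nonneg) (use pos[of _ 0] in \<open>simp add: inner_add_left\<close>)
  show False
  proof (cases "b = 0")
    \<comment> \<open>Here \<open>a\<close> alone would certify that the dual constraints have no
      solution, which \<open>p0\<close> refutes.\<close>
    case True
    then have "0 \<le> (B *v a) \<bullet> p0"
      using Ba p0(1) by (simp add: inner_vec_nonneg)
    then show False
      using sep True p0(2) inner_transpose_mult[of a B p0] by simp
  next
    case False
    with \<open>0 \<le> b\<close> have "0 < b" by simp
    \<comment> \<open>Normalising the separator to \<open>b = 1\<close> and negating
      \<open>a\<close> gives a primal feasible point whose objective exceeds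
      \<open>z\<close>.\<close>
    have "(B *v ((- 1 / b) *\<^sub>R a)) $ i \<le> c $ i" for i
    proof -
      have "0 \<le> (B *v a) $ i + b * c $ i"
        using Ba by (simp add: less_eq_vec_def)
      then show ?thesis
        using \<open>0 < b\<close> unfolding matrix_vector_mult_scaleR by (simp add: field_simps)
    qed
    then have "d \<bullet> ((- 1 / b) *\<^sub>R a) \<le> z"
      by (intro bound) (simp add: less_eq_vec_def)
    then show False
      using sep \<open>0 < b\<close> by (simp add: field_simps inner_commute)
  qed
qed

text \<open>The dual belongs to a maximisation over all vectors \<open>y2\<close>, while
  \<open>phi\<close> admits only those in \<open>Y2\<close>; \<open>Y2_linear\<close> closes this
  gap. Together with \<open>rule_Y1\<close> it makes every completion of the rule that meets the
  constraints a competitor in \<open>phi\<close>.\<close>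

theorem proposition14:
  fixes Y1 :: "(real ^ 'ny1) set" and Y2 :: "(real ^ 'ny2) set"
    and A :: "real ^ 'nx ^ 'm" and B1 :: "real ^ 'ny1 ^ 'm" and B2 :: "real ^ 'ny2 ^ 'm"
    and h :: "real ^ 'm" and d1 :: "real ^ 'ny1" and d2 :: "real ^ 'ny2"
    and yt :: "real ^ 'nx \<Rightarrow> real ^ 'ny1"
  assumes Y1_binary: "Y1 \<subseteq> binary_vecs"
    and lower_level: "\<forall>x \<in> binary_vecs. lower_feasible_bounded Y1 Y2 A B1 B2 h d1 d2 x"
    and rule_binary: "\<forall>x \<in> binary_vecs. yt x \<in> binary_vecs"
    and Y2_linear: "\<forall>x \<in> binary_vecs. \<forall>y1 \<in> Y1. \<forall>y2.
        B1 *v y1 + B2 *v y2 \<le> h - A *v x \<longrightarrow> y2 \<in> Y2"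
    and rule_Y1: "\<forall>x \<in> binary_vecs. \<forall>y2.
        B1 *v yt x + B2 *v y2 \<le> h - A *v x \<longrightarrow> yt x \<in> Y1"
  shows "\<forall>x \<in> binary_vecs.
    ereal (d1 \<bullet> yt x) + dual_value A B1 B2 h d2 x (yt x) \<le> phi Y1 Y2 A B1 B2 h d1 d2 x"
proof
  fix x :: "real ^ 'nx"
  assume x: "x \<in> binary_vecs"
  let ?F = "lower_feasible Y1 Y2 A B1 B2 h x"
  let ?c = "\<lambda>y1. h - A *v x - B1 *v y1"
  have shift: "B2 *v y2 \<le> ?c y1 \<longleftrightarrow> B1 *v y1 + B2 *v y2 \<le> h - A *v x" for y1 y2
    by (simp add: less_eq_vec_def algebra_simps)
  have feasI: "(y1, y2) \<in> ?F" if "y1 \<in> Y1" "B2 *v y2 \<le> ?c y1" for y1 y2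
    using that x Y2_linear by (auto simp: lower_feasible_def shift)
  have ne: "?F \<noteq> {}" and bdd: "bdd_above (lower_obj d1 d2 ` ?F)"
    using lower_level x by (auto simp: lower_feasible_bounded_def)
  \<comment> \<open>A real copy of the value \<open>phi\<close>, since the Farkas lemmas need a real
    bound.\<close>
  define s where "s = (SUP y\<in>?F. lower_obj d1 d2 y)"
  have le_s: "d1 \<bullet> y1 + d2 \<bullet> y2 \<le> s" if "(y1, y2) \<in> ?F" for y1 y2
    using cSUP_upper[OF that bdd] by (simp add: s_def lower_obj_def)
  obtain y1 y2 where y: "(y1, y2) \<in> ?F"
    using ne by auto
  then have "y1 \<in> Y1" "B2 *v y2 \<le> ?c y1"
    by (auto simp: lower_feasible_def shift)
  moreover have "d2 \<bullet> y2' \<le> s - d1 \<bullet> y1" if "B2 *v y2' \<le> ?c y1" for y2'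
    using le_s[OF feasI[OF \<open>y1 \<in> Y1\<close> that]] by simp
  ultimately obtain p0 where p0: "0 \<le> p0" "transpose B2 *v p0 = d2"
    using dual_feasible_if_primal_bounded by metis
  \<comment> \<open>The completion \<open>y2'\<close> itself supplies the premise of
    \<open>rule_Y1\<close>.\<close>
  have "d2 \<bullet> y2' \<le> s - d1 \<bullet> yt x" if "B2 *v y2' \<le> ?c (yt x)" for y2'
  proof -
    have "yt x \<in> Y1"
      using rule_Y1 x that shift by blast
    then show ?thesis
      using le_s[OF feasI[OF _ that]] by simp
  qed
  from affine_farkas[OF p0 this]
  obtain p where p: "0 \<le> p" "transpose B2 *v p = d2" "?c (yt x) \<bullet> p \<le> s - d1 \<bullet> yt x"
    by blast
  have "dual_value A B1 B2 h d2 x (yt x) \<le> ereal (?c (yt x) \<bullet> p)"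
    unfolding dual_value_def using p by (intro INF_lower) simp
  then have "ereal (d1 \<bullet> yt x) + dual_value A B1 B2 h d2 x (yt x)
      \<le> ereal (d1 \<bullet> yt x) + ereal (?c (yt x) \<bullet> p)"
    by (rule add_left_mono)
  also have "\<dots> \<le> ereal s"
    using p(3) by simp
  also have "ereal s \<le> phi Y1 Y2 A B1 B2 h d1 d2 x"
  \<comment> \<open>Every real upper bound \<open>r\<close> of \<open>phi\<close> bounds all
    lower-level objective values, hence their real supremum \<open>s\<close>.\<close>
  proof (rule ereal_le_real)
    fix r
    assume r: "phi Y1 Y2 A B1 B2 h d1 d2 x \<le> ereal r"
    have "lower_obj d1 d2 y \<le> r" if "y \<in> ?F" for y
      using SUP_upper[OF that, of "\<lambda>y. ereal (lower_obj d1 d2 y)"] r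
      unfolding phi_def by (metis ereal_less_eq(3) order_trans)
    then show "ereal s \<le> ereal r"
      using ne by (simp add: s_def cSUP_least)
  qed
  finally show "ereal (d1 \<bullet> yt x) + dual_value A B1 B2 h d2 x (yt x) \<le> phi Y1 Y2 A B1 B2 h d1 d2 x" .
qed

end
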